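(* Let $p$ be a prime, let $a\in\mathbb{C}_p$ with $a\neq 0$, let $f(x)=\frac{a}{x^2}$ for $x\in\mathbb{C}_p\setminus\{0\}$, let $\alpha=(|a|_p)^{1/3}$, fix a cube root $a^{1/3}$ of $a$ in $\mathbb{C}_p$, and let $x_k=\theta_{k,3}a^{1/3}$, $k=1,2,3$, be the fixed points of $f$. Let $m\geq 3$ be an integer. Then the solutions $x\in\mathbb{C}_p\setminus\{0\}$ of the system $$f^m(x)=a^{\frac13(1-(-2)^m)}\cdot x^{(-2)^m}=x,\qquad |x-x_1|_p=|x-x_2|_p=|x-x_3|_p=\alpha$$ are exactly $$\hat x_j=a^{1/3}\cdot\begin{cases}\theta_{j,2^m-1}, & \text{if } m \text{ is even},\\ 1/\theta_{j,2^m+1}, & \text{if } m\text{ is odd},\end{cases}$$ where $(j,p)\in M_m$.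
   Context: $\mathbb{C}_p$ is the field of complex $p$-adic numbers (the completion of the algebraic closure of $\mathbb{Q}_p$) with the $p$-adic norm $|\cdot|_p$ normalized by $|p|_p=1/p$. $f^m$ is the $m$-fold composition of $f$. For a positive integer $n$, $\theta_{j,n}$, $j=1,\dots,n$, denote the $n$-th roots of unity in $\mathbb{C}_p$, with $\theta_{1,n}=1$. For $m$ even, $M_m$ is the set of pairs $(j,p)$ with $1\le j\le 2^m-1$ such that $|\theta_{k,3}-\theta_{j,2^m-1}|_p=1$ for all $k=1,2,3$; for $m$ odd, $M_m$ is the set of pairs $(j,p)$ with $1\le j\le 2^m+1$ such that $|\theta_{k,3}-\theta_{j,2^m+1}|_p=1$ for all $k=1,2,3$. *)

theory Defs
  imports "HOL-Analysis.Abstract_Metric_Spaces" "HOL-Algebra.Algebraic_Closure_Type"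
begin

definition padic_abs :: "nat \<Rightarrow> rat \<Rightarrow> real" where
  "padic_abs p r = (if r = 0 then 0
     else real p powi (int (multiplicity (int p) (snd (quotient_of r)))
                       - int (multiplicity (int p) (fst (quotient_of r)))))"

locale nonarch_abs_value =
  fixes nrm :: "'c::field_char_0 \<Rightarrow> real"
  assumes nrm_nonneg: "0 \<le> nrm x"
    and nrm_eq_0_iff: "nrm x = 0 \<longleftrightarrow> x = 0"
    and nrm_mult: "nrm (x * y) = nrm x * nrm y"
    and nrm_ultrametric: "nrm (x + y) \<le> max (nrm x) (nrm y)"
begin

lemma nrm_minus: "nrm (- x) = nrm x"
proof -
  have "nrm (- x) ^ 2 = nrm x ^ 2"
    using nrm_mult[of "- x" "- x"] nrm_mult[of x x] by (simp add: power2_eq_square)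
  then show ?thesis
    using nrm_nonneg power2_eq_iff_nonneg by blast
qed

sublocale Metric_space "UNIV :: 'c set" "\<lambda>x y. nrm (x - y)"
proof
  fix x y z :: 'c
  show "0 \<le> nrm (x - y)" by (rule nrm_nonneg)
  show "nrm (x - y) = nrm (y - x)" using nrm_minus[of "x - y"] by simp
  show "nrm (x - y) = 0 \<longleftrightarrow> x = y" by (simp add: nrm_eq_0_iff)
  show "nrm (x - z) \<le> nrm (x - y) + nrm (y - z)"
    using nrm_ultrametric[of "x - y" "y - z"] nrm_nonneg[of "x - y"] nrm_nonneg[of "y - z"]
    by simp
qed

end

text \<open>
  The field \<open>\<complex>\<^sub>p\<close>, characterised up to isometric isomorphism: the type \<open>'c\<close> with the absolute
  value \<open>nrm\<close> is a completion of an algebraic closure \<open>A\<close> of \<open>\<rat>\<^sub>p\<close>, where \<open>\<rat>\<^sub>p\<close> is the completion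
  of \<open>\<rat>\<close> for the \<open>p\<close>-adic absolute value.  As \<open>'c\<close> is complete, the completion of \<open>\<rat>\<close> is its
  closure in \<open>'c\<close>.
\<close>

locale padic_complex = nonarch_abs_value nrm
  for p :: nat and nrm :: "'c::field_char_0 \<Rightarrow> real" +
  assumes prime_p: "Factorial_Ring.prime p"
    and nrm_of_rat: "nrm (of_rat r) = padic_abs p r"
    and complete: "mcomplete"
    and completion_of_algebraic_closure:
      "\<exists>A. algebraic_closure (ring_of_type_algebra\<lparr>carrier := A\<rparr>) (mtopology closure_of \<rat>)
           \<and> mtopology closure_of A = UNIV"

definition enumerates_roots_of_unity :: "(nat \<Rightarrow> nat \<Rightarrow> 'c::field_char_0) \<Rightarrow> bool" where
  "enumerates_roots_of_unity \<theta> \<longleftrightarrow>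
     (\<forall>n\<ge>1. bij_betw (\<lambda>j. \<theta> j n) {1..n} {z. z ^ n = 1} \<and> \<theta> 1 n = 1)"

text \<open>
  Since \<open>\<complex>\<^sub>p\<close>, its norm and the roots of unity \<open>\<theta>\<close> depend on \<open>p\<close>, the set \<open>M\<^sub>m\<close> of pairs \<open>(j, p)\<close> is
  given by its section at the prime \<open>p\<close> belonging to \<open>nrm\<close>: \<open>j \<in> M_section nrm \<theta> m\<close> means
  \<open>(j, p) \<in> M\<^sub>m\<close>.
\<close>

definition M_section :: "('c::field_char_0 \<Rightarrow> real) \<Rightarrow> (nat \<Rightarrow> nat \<Rightarrow> 'c) \<Rightarrow> nat \<Rightarrow> nat set" where
  "M_section nrm \<theta> m =
     (if even m
      then {j. 1 \<le> j \<and> j \<le> 2 ^ m - 1 \<and> (\<forall>k\<in>{1,2,3}. nrm (\<theta> k 3 - \<theta> j (2 ^ m - 1)) = 1)}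
      else {j. 1 \<le> j \<and> j \<le> 2 ^ m + 1 \<and> (\<forall>k\<in>{1,2,3}. nrm (\<theta> k 3 - \<theta> j (2 ^ m + 1)) = 1)})"

end

theory Submission
  imports Defs
begin

text \<open>
  Scaling by the cube root turns the problem into one about roots of unity. Write \<open>x = c * t\<close>
  with \<open>c ^ 3 = a\<close> and \<open>N = (-2) ^ m\<close>. Since \<open>N\<close> is \<open>1\<close> modulo \<open>3\<close>, the factor
  \<open>a powi ((1 - N) div 3)\<close> is \<open>c powi (1 - N)\<close>, so the iterate of \<open>f\<close> at \<open>x\<close> is \<open>c * t powi N\<close>,
  and the fixed-point equation says that \<open>t powi (N - 1) = 1\<close>: \<open>t\<close> is a root of unity of order
  dividing \<open>2 ^ m - 1\<close> or \<open>2 ^ m + 1\<close>, according to the parity of \<open>m\<close>.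

  Because \<open>nrm c = \<alpha>\<close>, the three sphere conditions on \<open>x\<close> say exactly that \<open>t\<close> has distance \<open>1\<close>
  from every cube root of unity. For even \<open>m\<close> this is the condition that defines \<open>M_section\<close>.
  For odd \<open>m\<close> the solutions are parametrised by \<open>1 / t\<close> instead, which changes nothing: inversion
  permutes the cube roots of unity and preserves distances between elements of norm \<open>1\<close>
  (lemma \<open>unit_distance_inverse_iff\<close>).
\<close>

lemma three_times_cubic_exponent: "3 * ((1 - (-2) ^ m) div 3) = (1 - (-2) ^ m :: int)"
proof -
  have "(-2) ^ m mod 3 = ((-2) mod 3) ^ m mod (3::int)"
    by (rule power_mod[symmetric])
  then have "1 mod 3 = (-2) ^ m mod (3::int)"
    by simp
  then have "3 dvd (1 - (-2) ^ m :: int)"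
    by (simp only: mod_eq_dvd_iff)
  then show ?thesis by simp
qed

lemma funpow_inverse_square:
  fixes a x :: "'c::field"
  assumes "a \<noteq> 0" and f: "\<And>x. x \<noteq> 0 \<Longrightarrow> f x = a / x ^ 2" and "x \<noteq> 0"
  shows "(f ^^ m) x = a powi ((1 - (-2) ^ m) div 3) * x powi ((-2) ^ m)"
proof (induction m)
  case 0
  then show ?case by simp
next
  case (Suc m)
  define e :: "nat \<Rightarrow> int" where "e k = (1 - (-2) ^ k) div 3" for k
  define N :: int where "N = (-2) ^ m"
  have e_Suc: "e (Suc m) = 1 - e m * 2"
    using three_times_cubic_exponent[of m] three_times_cubic_exponent[of "Suc m"]
    by (simp add: e_def)
  have "(f ^^ Suc m) x = a / (a powi e m * x powi N) ^ 2"
    using Suc assms(1,3) by (simp add: f e_def N_def)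
  also have "\<dots> = a / (a powi (e m * 2) * x powi (N * 2))"
    by (simp add: power_mult_distrib power_int_mult)
  also have "\<dots> = a powi (1 - e m * 2) * x powi (- (N * 2))"
    using assms(1,3) by (simp add: power_int_diff power_int_minus field_simps)
  finally show ?case
    unfolding e_Suc[symmetric] by (simp add: e_def N_def mult.commute)
qed

lemma cube_root_scaling:
  fixes c t :: "'c::field"
  assumes "c \<noteq> 0"
  shows "(c ^ 3) powi ((1 - (-2) ^ m) div 3) * (c * t) powi ((-2) ^ m) = c * t powi ((-2) ^ m)"
proof -
  have "(c ^ 3) powi ((1 - (-2) ^ m) div 3) = c powi (3 * ((1 - (-2) ^ m) div 3))"
    by (simp add: power_int_mult)
  also have "\<dots> = c powi (1 - (-2) ^ m)"
    by (simp only: three_times_cubic_exponent)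
  finally show ?thesis
    using assms by (simp add: power_int_mult_distrib power_int_diff)
qed

lemma fixed_power_iff_root_of_unity:
  fixes t :: "'c::field"
  assumes "t \<noteq> 0"
  shows "t powi ((-2) ^ m) = t \<longleftrightarrow> t ^ (if even m then 2 ^ m - 1 else 2 ^ m + 1) = 1"
proof (cases "even m")
  case True
  have "t powi ((-2) ^ m) = t powi (int (2 ^ m))"
    using True by simp
  also have "\<dots> = t ^ (2 ^ m)"
    by (rule power_int_of_nat)
  also have "\<dots> = t * t ^ (2 ^ m - 1)"
    by (metis power_eq_if power_not_zero zero_neq_numeral)
  finally show ?thesis
    using True assms by simp
next
  case False
  have "t powi ((-2) ^ m) = t powi (- int (2 ^ m))"
    using False by simp
  also have "\<dots> = inverse (t ^ (2 ^ m))"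
    by (simp only: power_int_minus power_int_of_nat)
  finally have "t powi ((-2) ^ m) = t \<longleftrightarrow> inverse (t ^ (2 ^ m)) = t"
    by simp
  also have "\<dots> \<longleftrightarrow> t ^ (2 ^ m + 1) = 1"
    using assms by (auto simp: field_simps)
  finally show ?thesis
    using False by simp
qed

lemma all_enumerated_cube_roots_iff:
  assumes "enumerates_roots_of_unity \<theta>"
  shows "(\<forall>k\<in>{1,2,3}. P (\<theta> k 3)) \<longleftrightarrow> (\<forall>z. z ^ 3 = 1 \<longrightarrow> P z)"
proof -
  have "bij_betw (\<lambda>j. \<theta> j 3) {1..3} {z. z ^ 3 = 1}"
    using assms by (simp add: enumerates_roots_of_unity_def)
  moreover have "{1..3} = {1,2,3::nat}" by auto
  ultimately have "(\<lambda>j. \<theta> j 3) ` {1,2,3} = {z. z ^ 3 = 1}"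
    by (simp only: bij_betw_imp_surj_on)
  then have "(\<forall>z\<in>(\<lambda>j. \<theta> j 3) ` {1,2,3}. P z) \<longleftrightarrow> (\<forall>z. z ^ 3 = 1 \<longrightarrow> P z)"
    by simp
  then show ?thesis by simp
qed

lemma all_roots_of_unity_inverse_iff:
  fixes P :: "'c::field \<Rightarrow> bool"
  shows "(\<forall>z. z ^ n = 1 \<longrightarrow> P z) \<longleftrightarrow> (\<forall>z. z ^ n = 1 \<longrightarrow> P (inverse z))"
proof (intro iffI allI impI)
  fix z :: 'c assume "\<forall>z. z ^ n = 1 \<longrightarrow> P (inverse z)" "z ^ n = 1"
  moreover have "inverse z ^ n = 1"
    using \<open>z ^ n = 1\<close> by (simp add: power_inverse)
  ultimately have "P (inverse (inverse z))" by blast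
  then show "P z" by simp
qed (simp add: power_inverse)

lemma (in nonarch_abs_value) nrm_one: "nrm 1 = 1"
  using nrm_mult[of 1 1] by (simp add: nrm_eq_0_iff)

lemma (in nonarch_abs_value) nrm_power: "nrm (x ^ n) = nrm x ^ n"
  by (induction n) (simp_all add: nrm_one nrm_mult)

lemma (in nonarch_abs_value) nrm_root_of_unity:
  assumes "t ^ n = 1" "n \<ge> 1"
  shows "nrm t = 1"
proof -
  have "nrm t ^ n = 1"
    using nrm_power[of t n] assms(1) nrm_one by simp
  then show ?thesis
    using power_eq_imp_eq_base[of "nrm t" n 1] assms(2) nrm_nonneg[of t] by simp
qed

text \<open>
  From \<open>t * (inverse z - inverse t) = - inverse z * (z - t)\<close>, the distance from \<open>inverse t\<close> to
  \<open>inverse z\<close> is the distance from \<open>t\<close> to \<open>z\<close> when both have norm \<open>1\<close>; and with \<open>z\<close>, also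
  \<open>inverse z\<close> runs through all \<open>n\<close>-th roots of unity.
\<close>

lemma (in nonarch_abs_value) unit_distance_inverse_iff:
  assumes t: "nrm t = 1" and n: "n \<ge> 1"
  shows "(\<forall>z. z ^ n = 1 \<longrightarrow> nrm (z - inverse t) = 1) \<longleftrightarrow> (\<forall>z. z ^ n = 1 \<longrightarrow> nrm (z - t) = 1)"
proof -
  have dist: "nrm (inverse z - inverse t) = nrm (z - t)" if "z ^ n = 1" for z
  proof -
    have nz: "nrm z = 1" using that n by (rule nrm_root_of_unity)
    have "z \<noteq> 0" "t \<noteq> 0" using nz t nrm_eq_0_iff[of z] nrm_eq_0_iff[of t] by auto
    then have "z - t = - (z * t * (inverse z - inverse t))"
      by (simp add: field_simps)
    then show ?thesis by (simp add: nrm_minus nrm_mult nz t)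
  qed
  from all_roots_of_unity_inverse_iff[of n "\<lambda>z. nrm (z - inverse t) = 1"] show ?thesis
    using dist by simp
qed

lemma solution_order_pos:
  assumes "m \<ge> 1"
  shows "(if even m then 2 ^ m - 1 else 2 ^ m + 1) \<ge> (1::nat)"
proof -
  have "(2::nat) ^ 1 \<le> 2 ^ m"
    using assms by (rule power_increasing) simp
  then show ?thesis by auto
qed

lemma M_section_image:
  fixes \<theta> :: "nat \<Rightarrow> nat \<Rightarrow> 'c::field_char_0"
  assumes \<theta>: "enumerates_roots_of_unity \<theta>" and "m \<ge> 1"
    and n: "n = (if even m then 2 ^ m - 1 else 2 ^ m + 1)"
  shows "(\<lambda>j. \<theta> j n) ` M_section nrm \<theta> m
       = {t. t ^ n = 1 \<and> (\<forall>z. z ^ 3 = 1 \<longrightarrow> nrm (z - t) = 1)}"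
proof -
  have "n \<ge> 1"
    unfolding n using \<open>m \<ge> 1\<close> by (rule solution_order_pos)
  then have roots: "(\<lambda>j. \<theta> j n) ` {1..n} = {t. t ^ n = 1}"
    using \<theta> by (simp add: enumerates_roots_of_unity_def bij_betw_imp_surj_on)
  have "M_section nrm \<theta> m = {j \<in> {1..n}. \<forall>k\<in>{1,2,3}. nrm (\<theta> k 3 - \<theta> j n) = 1}"
    using n by (auto simp: M_section_def)
  also have "\<dots> = {j \<in> {1..n}. \<forall>z. z ^ 3 = 1 \<longrightarrow> nrm (z - \<theta> j n) = 1}"
    using all_enumerated_cube_roots_iff[OF \<theta>] by (intro Collect_cong conj_cong refl)
  finally have "(\<lambda>j. \<theta> j n) ` M_section nrm \<theta> m
      = {t \<in> (\<lambda>j. \<theta> j n) ` {1..n}. \<forall>z. z ^ 3 = 1 \<longrightarrow> nrm (z - t) = 1}"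
    by (simp only:) auto
  then show ?thesis
    unfolding roots by simp
qed

theorem lemma10:
  fixes p m :: nat
    and nrm :: "'c::field_char_0 \<Rightarrow> real"
    and \<theta> :: "nat \<Rightarrow> nat \<Rightarrow> 'c"
    and a cbrt_a :: 'c
    and f :: "'c \<Rightarrow> 'c"
    and x_fix :: "nat \<Rightarrow> 'c"
    and \<alpha> :: real
  assumes "padic_complex p nrm"
    and "enumerates_roots_of_unity \<theta>"
    and "a \<noteq> 0"
    and "\<And>x. x \<noteq> 0 \<Longrightarrow> f x = a / x ^ 2"
    and "\<alpha> = nrm a powr (1 / 3)"
    and "cbrt_a ^ 3 = a"
    and "\<And>k. x_fix k = \<theta> k 3 * cbrt_a"
    and "m \<ge> 3"
  shows "{x. x \<noteq> 0
           \<and> (f ^^ m) x = a powi ((1 - (-2) ^ m) div 3) * x powi ((-2) ^ m)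
           \<and> a powi ((1 - (-2) ^ m) div 3) * x powi ((-2) ^ m) = x
           \<and> nrm (x - x_fix 1) = \<alpha> \<and> nrm (x - x_fix 2) = \<alpha> \<and> nrm (x - x_fix 3) = \<alpha>}
       = {cbrt_a * (if even m then \<theta> j (2 ^ m - 1) else 1 / \<theta> j (2 ^ m + 1)) | j.
           j \<in> M_section nrm \<theta> m}"
proof -
  interpret padic_complex p nrm by fact
  define n :: nat where "n = (if even m then 2 ^ m - 1 else 2 ^ m + 1)"
  define far :: "'c \<Rightarrow> bool" where "far t \<longleftrightarrow> (\<forall>z. z ^ 3 = 1 \<longrightarrow> nrm (z - t) = 1)" for t
  define orbit where "orbit x = a powi ((1 - (-2) ^ m) div 3) * x powi ((-2) ^ m)" for x
  have "n \<ge> 1"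
    unfolding n_def using assms(8) by (intro solution_order_pos) simp
  have c: "cbrt_a \<noteq> 0"
    using assms(3,6) by auto
  have "\<alpha> = (nrm cbrt_a ^ 3) powr (1 / 3)"
    using assms(5,6) nrm_power[of cbrt_a 3] by simp
  then have \<alpha>: "\<alpha> = nrm cbrt_a"
    using c nrm_nonneg[of cbrt_a] nrm_eq_0_iff[of cbrt_a]
    by (simp add: powr_powr flip: powr_numeral)
  have "\<alpha> \<noteq> 0"
    using \<alpha> c by (simp add: nrm_eq_0_iff)

  have sphere: "nrm (cbrt_a * t - x_fix k) = \<alpha> \<longleftrightarrow> nrm (\<theta> k 3 - t) = 1" for t k
  proof -
    have "cbrt_a * t - x_fix k = - (cbrt_a * (\<theta> k 3 - t))"
      by (simp add: assms(7) algebra_simps)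
    then have "nrm (cbrt_a * t - x_fix k) = \<alpha> * nrm (\<theta> k 3 - t)"
      by (simp only: nrm_minus nrm_mult \<alpha>)
    then show ?thesis using \<open>\<alpha> \<noteq> 0\<close> by simp
  qed
  have solution: "cbrt_a * t \<noteq> 0 \<and> (f ^^ m) (cbrt_a * t) = orbit (cbrt_a * t)
      \<and> orbit (cbrt_a * t) = cbrt_a * t
      \<and> nrm (cbrt_a * t - x_fix 1) = \<alpha> \<and> nrm (cbrt_a * t - x_fix 2) = \<alpha>
      \<and> nrm (cbrt_a * t - x_fix 3) = \<alpha> \<longleftrightarrow> t ^ n = 1 \<and> far t" for t
  proof (cases "t = 0")
    case True
    then show ?thesis using \<open>n \<ge> 1\<close> by (simp add: zero_power)
  next
    case False
    have "(f ^^ m) (cbrt_a * t) = orbit (cbrt_a * t)"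
      unfolding orbit_def using False c assms(3,4) by (intro funpow_inverse_square) auto
    moreover have "orbit (cbrt_a * t) = cbrt_a * t \<longleftrightarrow> t ^ n = 1"
      using cube_root_scaling[OF c, of m t] fixed_power_iff_root_of_unity[OF False, of m] c
      by (simp add: orbit_def assms(6) n_def)
    moreover have "far t \<longleftrightarrow> (\<forall>k\<in>{1,2,3}. nrm (\<theta> k 3 - t) = 1)"
      unfolding far_def by (rule all_enumerated_cube_roots_iff[OF assms(2), symmetric])
    ultimately show ?thesis
      using False c sphere by simp
  qed
  have surj_scale: "\<exists>t. x = cbrt_a * t" for x
    using c by (intro exI[of _ "x / cbrt_a"]) simp

  define R where "R = {t. t ^ n = 1 \<and> far t}"
  have R_inverse: "inverse t \<in> R" if "t \<in> R" for t
    using that \<open>n \<ge> 1\<close> unit_distance_inverse_iff[of t 3] nrm_root_of_unity[of t n]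
    by (simp add: R_def far_def power_inverse)
  have "inverse ` R = R"
    using R_inverse by (force intro: image_eqI[of _ inverse "inverse _"])
  have "{x. x \<noteq> 0 \<and> (f ^^ m) x = orbit x \<and> orbit x = x
      \<and> nrm (x - x_fix 1) = \<alpha> \<and> nrm (x - x_fix 2) = \<alpha> \<and> nrm (x - x_fix 3) = \<alpha>}
    = (\<lambda>t. cbrt_a * t) ` R"
  proof (rule Set.set_eqI)
    fix x
    obtain t where x: "x = cbrt_a * t" using surj_scale by blast
    have "x \<in> (\<lambda>t. cbrt_a * t) ` R \<longleftrightarrow> t ^ n = 1 \<and> far t"
      using c by (auto simp: x R_def)
    then show "x \<in> {x. x \<noteq> 0 \<and> (f ^^ m) x = orbit x \<and> orbit x = x
        \<and> nrm (x - x_fix 1) = \<alpha> \<and> nrm (x - x_fix 2) = \<alpha> \<and> nrm (x - x_fix 3) = \<alpha>}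
      \<longleftrightarrow> x \<in> (\<lambda>t. cbrt_a * t) ` R"
      using solution[of t] by (simp only: x mem_Collect_eq)
  qed
  also have "\<dots> = (\<lambda>t. cbrt_a * (if even m then t else 1 / t)) ` R"
  proof (cases "even m")
    case False
    have "(\<lambda>t. cbrt_a * t) ` inverse ` R = (\<lambda>t. cbrt_a * (1 / t)) ` R"
      by (simp add: image_image divide_inverse)
    then show ?thesis using False \<open>inverse ` R = R\<close> by simp
  qed simp
  also have "R = (\<lambda>j. \<theta> j n) ` M_section nrm \<theta> m"
    using M_section_image[OF assms(2) _ n_def] assms(8) by (simp add: R_def far_def)
  also have "(\<lambda>t. cbrt_a * (if even m then t else 1 / t)) ` \<dots>
    = {cbrt_a * (if even m then \<theta> j (2 ^ m - 1) else 1 / \<theta> j (2 ^ m + 1)) | j.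
           j \<in> M_section nrm \<theta> m}"
    by (auto simp: n_def)
  finally show ?thesis
    unfolding orbit_def .
qed

end
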